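(* Let $\alpha>0$, $p\in[1,2]$ and let $\mu$ be an $\alpha$-regular $p$-exponential measure in $C[0,1]$. Then as $\epsilon\to0$ $$-\log\mu\left(\{u\in C[0,1]:\|u\|_{L_\infty}\le\epsilon\}\right)\lesssim\epsilon^{-\frac1\alpha}.$$
   Context: Let $\{\psi_{kl}:k\in\mathbb{N}_0,\ l=1,\dots,2^k\}$ be an orthonormal wavelet basis of $L_2[0,1]$ of Cohen–Daubechies–Vial type, consisting of $S$-Hölder continuous functions for some $S>\alpha$, which is a Schauder basis of $C[0,1]$ and such that there are constants $C_1,C_2>0$ with: $|\psi_{kl}(x)-\psi_{kl}(y)|\le C_12^{\frac k2+k\vartheta}|x-y|^\vartheta$ for $\vartheta\le S\wedge1$; and $\|\sum_{l=1}^{2^k}u_{kl}\psi_{kl}\|_{L_\infty}\le C_22^{\frac k2}\sup_{1\le l\le2^k}|u_{kl}|$ for all coefficients. The $\alpha$-regular $p$-exponential measure in $C[0,1]$ is the law of $u=\sum_{k=0}^\infty\sum_{l=1}^{2^k}2^{-(\frac12+\alpha)k}\xi_{kl}\psi_{kl}$, where $\xi_{kl}$ are i.i.d. real random variables with density proportional to $\exp(-|x|^p/p)$. $A(\epsilon)\lesssim B(\epsilon)$ means $A(\epsilon)/B(\epsilon)$ is bounded as $\epsilon\to0$. *)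

theory Defs
  imports
    "HOL-Probability.Probability"
    "HOL-Library.Discrete_Functions"
    "HOL-Library.Landau_Symbols"
begin

section \<open>The Banach space \<open>C[0,1]\<close>\<close>

text \<open>The elements are functions that are \<^const>\<open>undefined\<close> outside the unit interval
  (see \<open>mspace_C01\<close>).\<close>

abbreviation C01 :: "(real \<Rightarrow> real) metric" where
  "C01 \<equiv> cfunspace (top_of_set {0..1}) euclidean_metric"

lemma mspace_C01: "mspace C01 = {f \<in> extensional {0..1}. continuous_on {0..1} f}"
proof -
  have "bounded (f ` {0..1})" if "continuous_on {0..1} f" for f :: "real \<Rightarrow> real"
    using that by (intro compact_imp_bounded compact_continuous_image) auto
  then show ?thesis
    by auto
qed

definition borel_C01 :: "(real \<Rightarrow> real) measure" where
  "borel_C01 = sigma (mspace C01) {U. openin (mtopology_of C01) U}"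

definition sup_norm :: "(real \<Rightarrow> real) \<Rightarrow> real" where
  "sup_norm f = (SUP x\<in>{0..1}. \<bar>f x\<bar>)"

definition schauder_basis_C01 :: "(nat \<Rightarrow> real \<Rightarrow> real) \<Rightarrow> bool" where
  "schauder_basis_C01 e \<longleftrightarrow>
     (\<forall>n. continuous_on {0..1} (e n)) \<and>
     (\<forall>f\<in>mspace C01. \<exists>!c :: nat \<Rightarrow> real.
        limitin (mtopology_of C01) (\<lambda>n. \<lambda>x\<in>{0..1}. \<Sum>i<n. c i * e i x) f sequentially)"

text \<open>For \<open>S > 1\<close>, \<open>S\<close>-Hoelder continuity is understood as usual: with \<open>S = m + r\<close>, \<open>0 < r \<le> 1\<close>, the
  function has \<open>m\<close> derivatives (\<open>D j\<close> is the \<open>j\<close>-th), the last of which is \<open>r\<close>-Hoelder.\<close>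

definition holder01 :: "real \<Rightarrow> (real \<Rightarrow> real) \<Rightarrow> bool" where
  "holder01 S f \<longleftrightarrow>
     (\<exists>(m :: nat) (r :: real) (D :: nat \<Rightarrow> real \<Rightarrow> real) L.
        S = real m + r \<and> 0 < r \<and> r \<le> 1 \<and>
        (\<forall>x\<in>{0..1}. D 0 x = f x) \<and>
        (\<forall>j<m. \<forall>x\<in>{0..1}. (D j has_real_derivative D (Suc j) x) (at x within {0..1})) \<and>
        (\<forall>x\<in>{0..1}. \<forall>y\<in>{0..1}. \<bar>D m x - D m y\<bar> \<le> L * \<bar>x - y\<bar> powr r))"


section \<open>Wavelet bases\<close>

definition wavelet_index :: "(nat \<times> nat) set" where
  "wavelet_index = (SIGMA k:UNIV. {1..2 ^ k})"

definition L2_01 :: "(real \<Rightarrow> real) \<Rightarrow> bool" where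
  "L2_01 f \<longleftrightarrow> set_borel_measurable lborel {0..1} f \<and>
     set_integrable lborel {0..1} (\<lambda>x. (f x)\<^sup>2)"

definition orthonormal_basis_L2 :: "(nat \<Rightarrow> nat \<Rightarrow> real \<Rightarrow> real) \<Rightarrow> bool" where
  "orthonormal_basis_L2 \<psi> \<longleftrightarrow>
     (\<forall>(k, l)\<in>wavelet_index. L2_01 (\<psi> k l)) \<and>
     (\<forall>(k, l)\<in>wavelet_index. \<forall>(k', l')\<in>wavelet_index.
        (LBINT x:{0..1}. \<psi> k l x * \<psi> k' l' x) = (if (k, l) = (k', l') then 1 else 0)) \<and>
     (\<forall>f. L2_01 f \<longrightarrow>
        (\<forall>\<delta>>0. \<exists>F c. finite F \<and> F \<subseteq> wavelet_index \<and>
           sqrt (LBINT x:{0..1}. (f x - (\<Sum>(k, l)\<in>F. c k l * \<psi> k l x))\<^sup>2) < \<delta>))"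

text \<open>A Schauder basis is an ordered family; the double index is enumerated level by level, i.e.
  in the order \<open>(0,1), (1,1), (1,2), (2,1), (2,2), (2,3), (2,4), (3,1), \<dots>\<close>\<close>

definition wavelet_enum :: "(nat \<Rightarrow> nat \<Rightarrow> real \<Rightarrow> real) \<Rightarrow> nat \<Rightarrow> real \<Rightarrow> real" where
  "wavelet_enum \<psi> n = (let k = floor_log (n + 1) in \<psi> k (n + 2 - 2 ^ k))"

text \<open>The locale collects the properties of \<open>S\<close>-regular Cohen--Daubechies--Vial bases; it does not
  fix a particular construction. Only the values of \<open>\<psi> k l\<close> on the unit interval and for
  \<open>1 \<le> l \<le> 2 ^ k\<close> matter.\<close>

locale cdv_wavelet_basis =
  fixes S :: real and \<psi> :: "nat \<Rightarrow> nat \<Rightarrow> real \<Rightarrow> real"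
  assumes orthonormal_basis: "orthonormal_basis_L2 \<psi>"
    and holder: "\<And>k l. l \<in> {1..2 ^ k} \<Longrightarrow> holder01 S (\<psi> k l)"
    and schauder_basis: "schauder_basis_C01 (wavelet_enum \<psi>)"
    and holder_bound:
      "\<exists>C\<^sub>1>0. \<forall>k. \<forall>l\<in>{1..2 ^ k}. \<forall>\<theta>. 0 < \<theta> \<and> \<theta> \<le> min S 1 \<longrightarrow>
         (\<forall>x\<in>{0..1}. \<forall>y\<in>{0..1}.
            \<bar>\<psi> k l x - \<psi> k l y\<bar> \<le> C\<^sub>1 * 2 powr (real k / 2 + real k * \<theta>) * \<bar>x - y\<bar> powr \<theta>)"
    and sup_bound:
      "\<exists>C\<^sub>2>0. \<forall>k (v :: nat \<Rightarrow> real).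
         sup_norm (\<lambda>x. \<Sum>l=1..2 ^ k. v l * \<psi> k l x)
           \<le> C\<^sub>2 * 2 powr (real k / 2) * (SUP l\<in>{1..2 ^ k}. \<bar>v l\<bar>)"


section \<open>\<open>p\<close>-exponential measures\<close>

definition p_exponential_density :: "real \<Rightarrow> real \<Rightarrow> real" where
  "p_exponential_density p x =
     exp (- (\<bar>x\<bar> powr p / p)) / (LBINT y. exp (- (\<bar>y\<bar> powr p / p)))"

text \<open>The random element \<open>u\<close> of \<open>C[0,1]\<close> is almost surely the uniform limit of the random series.\<close>

locale p_exponential_series = prob_space M
  for M :: "'a measure" and \<alpha> p :: real and \<psi> :: "nat \<Rightarrow> nat \<Rightarrow> real \<Rightarrow> real"
    and \<xi> :: "nat \<Rightarrow> nat \<Rightarrow> 'a \<Rightarrow> real" and u :: "'a \<Rightarrow> real \<Rightarrow> real" +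
  assumes indep_xi: "indep_vars (\<lambda>_. borel) (\<lambda>(k, l). \<xi> k l) wavelet_index"
    and distributed_xi: "\<And>k l. (k, l) \<in> wavelet_index \<Longrightarrow>
      distributed M lborel (\<xi> k l) (\<lambda>x. ennreal (p_exponential_density p x))"
    and measurable_u: "u \<in> measurable M borel_C01"
    and series_converges: "AE \<omega> in M. limitin (mtopology_of C01)
      (\<lambda>n. \<lambda>x\<in>{0..1}. \<Sum>k<n. \<Sum>l=1..2 ^ k. 2 powr (- (1 / 2 + \<alpha>) * real k) * \<xi> k l \<omega> * \<psi> k l x)
      (u \<omega>) sequentially"

end

theory Submission
  imports Defs "HOL-Real_Asymp.Real_Asymp"
begin

text \<open>By the level-wise sup-norm bound,
  \<open>\<parallel>u\<parallel> \<le> C (\<Sum>k. 2 powr (-\<alpha> k) * Max l. \<bar>\<xi> k l\<bar>)\<close>, so if \<open>\<bar>\<xi> k l\<bar> \<le> t k\<close> for all indices and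
  \<open>2 powr (-\<alpha> k) * t k = 2 powr (-\<alpha> K) * q ^ \<bar>k - K\<bar>\<close> with \<open>q = 2 powr (-\<alpha> / 2)\<close>, then the norm is at
  most of order \<open>2 powr (-\<alpha> K) \<approx> \<epsilon>\<close>. By independence this event has probability
  \<open>\<Prod>k. P (\<bar>\<xi>\<bar> \<le> t k) ^ (2 ^ k)\<close>. For \<open>k \<le> K\<close> the factor \<open>P (\<bar>\<xi>\<bar> \<le> t)\<close> is at least of order \<open>t\<close>, and for
  \<open>k > K\<close> it is exponentially close to \<open>1\<close>; both parts of \<open>- ln\<close> of the product sum up to order
  \<open>2 ^ K \<approx> \<epsilon> powr (-1 / \<alpha>)\<close>.\<close>

section \<open>Limits and closed balls in \<open>C01\<close>\<close>

lemma mdist_C01_le_iff: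
  assumes "f \<in> mspace C01" "g \<in> mspace C01"
  shows "mdist C01 f g \<le> a \<longleftrightarrow> (\<forall>x\<in>{0..1}. \<bar>f x - g x\<bar> \<le> a)"
  using cfunspace_mdist_le[OF assms] by (simp add: dist_real_def)

text \<open>Evaluation at a point is 1-Lipschitz for the sup metric. This later carries bounds on
  partial sums over to the limit of the series.\<close>

lemma limitin_C01_imp_tendsto:
  assumes "limitin (mtopology_of C01) f g F" "x \<in> {0..1}"
  shows "((\<lambda>n. f n x) \<longlongrightarrow> g x) F"
proof -
  interpret Metric_space "mspace C01" "mdist C01"
    by (rule Metric_space_mspace_mdist)
  from assms(1) have g: "g \<in> mspace C01" and ev: "eventually (\<lambda>n. f n \<in> mspace C01) F"
    and lim: "((\<lambda>n. mdist C01 (f n) g) \<longlongrightarrow> 0) F"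
    unfolding mtopology_of_def limitin_metric_dist_null by blast+
  have "eventually (\<lambda>n. dist (f n x) (g x) \<le> mdist C01 (f n) g) F"
    using ev
  proof eventually_elim
    case (elim n)
    then show ?case
      using mdist_C01_le_iff[OF elim g, of "mdist C01 (f n) g"] assms(2) by (simp add: dist_real_def)
  qed
  then have "((\<lambda>n. dist (f n x) (g x)) \<longlongrightarrow> 0) F"
    by (intro tendsto_sandwich[OF _ _ tendsto_const lim]) auto
  then show ?thesis
    by (rule tendsto_dist_iff[THEN iffD2])
qed

text \<open>\<open>SUP\<close> over the reals is a genuine supremum only for sets that are bounded
  above, hence the assumption on \<open>f\<close>.\<close>

lemma sup_norm_le_iff:
  assumes "bounded (f ` {0..1})"
  shows "sup_norm f \<le> a \<longleftrightarrow> (\<forall>x\<in>{0..1}. \<bar>f x\<bar> \<le> a)"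
proof -
  have "bdd_above ((\<lambda>x. \<bar>f x\<bar>) ` {0..1})"
    using assms by (auto simp: bounded_iff intro: bdd_aboveI2)
  then show ?thesis
    unfolding sup_norm_def by (subst cSUP_le_iff) auto
qed

lemma bounded_image_C01:
  assumes "f \<in> mspace C01"
  shows "bounded (f ` {0..1})"
  using assms unfolding mspace_C01
  by (intro compact_imp_bounded compact_continuous_image) auto

lemma sup_norm_ball_eq:
  "{f \<in> mspace C01. sup_norm f \<le> \<epsilon>} =
     Metric_space.mcball (mspace C01) (mdist C01) (\<lambda>x\<in>{0..1}. 0) \<epsilon>"
proof -
  interpret Metric_space "mspace C01" "mdist C01"
    by (rule Metric_space_mspace_mdist)
  have 0: "(\<lambda>x\<in>{0..1}. 0) \<in> mspace C01"
    unfolding mspace_C01 by (auto cong: continuous_on_cong_simp)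
  show ?thesis
    using 0 mdist_C01_le_iff[OF 0] sup_norm_le_iff bounded_image_C01
    by (auto simp del: mspace_cfunspace)
qed

text \<open>The ball is a closed metric ball, so its complement is one of the open generators of
  \<open>borel_C01\<close>. Measurability is what allows passing from \<open>distr\<close> to a
  preimage under \<open>u\<close>.\<close>

lemma sup_norm_ball_in_sets: "{f \<in> mspace C01. sup_norm f \<le> \<epsilon>} \<in> sets borel_C01"
proof -
  interpret Metric_space "mspace C01" "mdist C01"
    by (rule Metric_space_mspace_mdist)
  let ?B = "{f \<in> mspace C01. sup_norm f \<le> \<epsilon>}"
  have op: "openin (mtopology_of C01) (mspace C01 - ?B)"
    unfolding sup_norm_ball_eq mtopology_of_def
    using openin_diff[OF openin_topspace closedin_mcball] unfolding topspace_mtopology .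
  have "Pow (mspace C01) \<supseteq> {U. openin (mtopology_of C01) U}"
    using openin_subset[of "mtopology_of C01"] unfolding topspace_mtopology_of by blast
  then have S: "sets borel_C01 = sigma_sets (mspace C01) {U. openin (mtopology_of C01) U}"
    "space borel_C01 = mspace C01"
    by (simp_all add: borel_C01_def sets_measure_of space_measure_of del: mspace_cfunspace)
  have "mspace C01 - ?B \<in> sets borel_C01"
    unfolding S using op by (auto intro: sigma_sets.Basic simp del: mspace_cfunspace)
  then have "space borel_C01 - (mspace C01 - ?B) \<in> sets borel_C01"
    by blast
  also have "space borel_C01 - (mspace C01 - ?B) = ?B"
    unfolding S by blast
  finally show ?thesis .
qed

section \<open>The one-dimensional \<open>p\<close>-exponential distribution\<close>

definition p_exponential_measure :: "real \<Rightarrow> real measure" where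
  "p_exponential_measure p = density lborel (\<lambda>x. ennreal (p_exponential_density p x))"

lemma sets_p_exponential_measure [measurable_cong, simp]:
  "sets (p_exponential_measure p) = sets borel"
  by (simp add: p_exponential_measure_def)

lemma p_exponential_density_measurable [measurable]:
  "p_exponential_density p \<in> borel_measurable borel"
  unfolding p_exponential_density_def by measurable

lemma emeasure_p_exponential_measure:
  assumes "A \<in> sets borel"
  shows "emeasure (p_exponential_measure p) A =
    (\<integral>\<^sup>+x. ennreal (p_exponential_density p x) * indicator A x \<partial>lborel)"
  using assms unfolding p_exponential_measure_def by (subst emeasure_density) auto

text \<open>Substituting \<open>x = 2 powr (1 / p) * y\<close> turns half the exponent into the full one.\<close>

lemma p_exponential_tail:
  assumes "prob_space (p_exponential_measure p)" "1 \<le> p" "p \<le> 2" "1 \<le> t"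
  shows "measure (p_exponential_measure p) (- {-t..t}) \<le> 2 * exp (- t / 4)"
proof -
  interpret prob_space "p_exponential_measure p" by fact
  define Z where "Z = (LBINT y. exp (- (\<bar>y\<bar> powr p / p)))"
  \<comment> \<open>The Bochner integral of a nonnegative function is nonnegative, also when it
    takes its default value 0.\<close>
  have Z: "Z \<ge> 0" unfolding Z_def by (auto simp: set_lebesgue_integral_def)
  let ?c = "2 powr (1 / p)"
  have c: "?c > 0" "?c \<le> 2"
    using powr_mono[of "1 / p" 1 "2::real"] assms by (auto simp: field_simps)
  have 1: "(\<integral>\<^sup>+x. ennreal (p_exponential_density p x) \<partial>lborel) = 1"
    using emeasure_space_1 emeasure_p_exponential_measure[of UNIV p]
    by (simp add: p_exponential_measure_def)
  have half: "(\<integral>\<^sup>+x. ennreal (exp (- (\<bar>x\<bar> powr p / (2 * p))) / Z) \<partial>lborel) = ennreal ?c"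
  proof -
    have "(\<integral>\<^sup>+x. ennreal (exp (- (\<bar>x\<bar> powr p / (2 * p))) / Z) \<partial>lborel) =
        ennreal ?c * (\<integral>\<^sup>+x. ennreal (exp (- (\<bar>?c * x\<bar> powr p / (2 * p))) / Z) \<partial>lborel)"
      using nn_integral_real_affine[of "\<lambda>x. ennreal (exp (- (\<bar>x\<bar> powr p / (2 * p))) / Z)" ?c 0] c
      by simp
    also have "(\<lambda>x. ennreal (exp (- (\<bar>?c * x\<bar> powr p / (2 * p))) / Z)) =
        (\<lambda>x. ennreal (p_exponential_density p x))"
    proof
      fix x :: real
      have "\<bar>?c * x\<bar> powr p = 2 * \<bar>x\<bar> powr p"
        using assms by (simp add: abs_mult powr_mult powr_powr)
      then show "ennreal (exp (- (\<bar>?c * x\<bar> powr p / (2 * p))) / Z) =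
          ennreal (p_exponential_density p x)"
        by (simp add: p_exponential_density_def Z_def)
    qed
    finally show ?thesis using 1 by simp
  qed
  have "emeasure (p_exponential_measure p) (- {-t..t}) =
      (\<integral>\<^sup>+x. ennreal (p_exponential_density p x) * indicator (- {-t..t}) x \<partial>lborel)"
    by (intro emeasure_p_exponential_measure) auto
  also have "\<dots> \<le> (\<integral>\<^sup>+x. ennreal (exp (- t / 4)) * ennreal (exp (- (\<bar>x\<bar> powr p / (2 * p))) / Z) \<partial>lborel)"
  proof (intro nn_integral_mono)
    fix x :: real
    show "ennreal (p_exponential_density p x) * indicator (- {-t..t}) x
      \<le> ennreal (exp (- t / 4)) * ennreal (exp (- (\<bar>x\<bar> powr p / (2 * p))) / Z)"
    proof (cases "\<bar>x\<bar> > t")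
      case True
      \<comment> \<open>\<open>1 \<le> t\<close> and \<open>1 \<le> p\<close> give the numerator,
        \<open>p \<le> 2\<close> the denominator. Half of the exponent is then at least
        \<open>t / 4\<close> and is traded for the factor \<open>exp (- t / 4)\<close>; the other
        half stays integrable by \<open>half\<close>.\<close>
      have "t / 2 \<le> \<bar>x\<bar> powr p / p"
      proof (rule frac_le)
        have "t \<le> \<bar>x\<bar> powr 1" using True assms by simp
        also have "\<dots> \<le> \<bar>x\<bar> powr p" using True assms by (intro powr_mono) auto
        finally show "t \<le> \<bar>x\<bar> powr p" .
      qed (use assms in auto)
      then have "exp (- (\<bar>x\<bar> powr p / p)) \<le> exp (- t / 4) * exp (- (\<bar>x\<bar> powr p / (2 * p)))"
        by (simp add: exp_add[symmetric])
      then have "p_exponential_density p x \<le> exp (- t / 4) * (exp (- (\<bar>x\<bar> powr p / (2 * p))) / Z)"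
        using Z unfolding p_exponential_density_def Z_def[symmetric]
        by (simp add: divide_right_mono)
      then show ?thesis using True Z
        by (auto simp: indicator_def ennreal_mult[symmetric] intro!: ennreal_leI)
    qed (auto simp: indicator_def)
  qed
  also have "\<dots> = ennreal (exp (- t / 4)) * ennreal ?c"
    by (subst nn_integral_cmult) (simp_all add: half)
  also have "\<dots> = ennreal (exp (- t / 4) * ?c)" by (simp add: ennreal_mult)
  finally have "measure (p_exponential_measure p) (- {-t..t}) \<le> exp (- t / 4) * ?c"
    by (simp add: emeasure_eq_measure)
  also have "\<dots> \<le> exp (- t / 4) * 2" using c by simp
  finally show ?thesis by simp
qed

text \<open>For \<open>\<bar>x\<bar> \<le> 1\<close> the exponent is at least \<open>-1\<close>, so
  the density is at least \<open>exp (- 1) / Z\<close> on an interval of length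
  \<open>2 * t\<close>.\<close>

lemma p_exponential_small_interval:
  assumes "prob_space (p_exponential_measure p)" "1 \<le> p"
  shows "\<exists>c>0. \<forall>t\<in>{0<..1}. c * t \<le> measure (p_exponential_measure p) {-t..t}"
proof -
  interpret prob_space "p_exponential_measure p" by fact
  define Z where "Z = (LBINT y. exp (- (\<bar>y\<bar> powr p / p)))"
  \<comment> \<open>Division by zero yields 0, so \<open>Z = 0\<close> would make the density
    vanish, against total mass 1.\<close>
  have "Z \<noteq> 0"
  proof
    assume "Z = 0"
    then have "p_exponential_density p = (\<lambda>_. 0)"
      by (auto simp: p_exponential_density_def Z_def)
    then show False
      using emeasure_space_1 emeasure_p_exponential_measure[of UNIV p]
      by (simp add: p_exponential_measure_def)
  qed
  moreover have "Z \<ge> 0" unfolding Z_def by (auto simp: set_lebesgue_integral_def)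
  ultimately have Z: "Z > 0" by simp
  define c where "c = 2 * (exp (- 1) / Z)"
  have "c * t \<le> measure (p_exponential_measure p) {-t..t}" if t: "t \<in> {0<..1}" for t
  proof -
    have "ennreal (c * t) = ennreal (exp (- 1) / Z) * emeasure lborel {-t..t}"
      using t Z by (simp add: c_def ennreal_mult[symmetric] mult_ac)
    also have "\<dots> = (\<integral>\<^sup>+x. ennreal (exp (- 1) / Z) * indicator {-t..t} x \<partial>lborel)"
      by (subst nn_integral_cmult_indicator) simp_all
    also have "\<dots> \<le> (\<integral>\<^sup>+x. ennreal (p_exponential_density p x) * indicator {-t..t} x \<partial>lborel)"
    proof (intro nn_integral_mono)
      fix x :: real
      have "exp (- 1) / Z \<le> p_exponential_density p x" if "\<bar>x\<bar> \<le> t"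
      proof -
        have "\<bar>x\<bar> powr p \<le> 1" using that t assms by (intro powr_le1) auto
        then have "\<bar>x\<bar> powr p / p \<le> 1" using assms by (simp add: field_simps)
        then show ?thesis
          using Z unfolding p_exponential_density_def Z_def[symmetric]
          by (simp add: divide_right_mono)
      qed
      then show "ennreal (exp (- 1) / Z) * indicator {-t..t} x
        \<le> ennreal (p_exponential_density p x) * indicator {-t..t} x"
        by (auto simp: indicator_def intro!: ennreal_leI)
    qed
    also have "\<dots> = emeasure (p_exponential_measure p) {-t..t}"
      by (simp add: emeasure_p_exponential_measure)
    finally show ?thesis by (simp add: emeasure_eq_measure)
  qed
  moreover have "c > 0" using Z by (simp add: c_def)
  ultimately show ?thesis by blast
qed

text \<open>Bounds of the form \<open>exp (- h) \<le> P\<close> become sums of the costs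
  \<open>h\<close> under powers and products. The first is the linear bound near 0, the second comes
  from the tail estimate.\<close>

lemma p_exponential_interval_lower_bound:
  assumes "prob_space (p_exponential_measure p)" "1 \<le> p" "p \<le> 2"
  obtains a b where "a \<ge> 0" "b \<ge> 0"
    "\<And>t. 0 < t \<Longrightarrow> t \<le> 1 \<Longrightarrow> exp (- (a - ln t)) \<le> measure (p_exponential_measure p) {-t..t}"
    "\<And>t. 1 \<le> t \<Longrightarrow> exp (- (b * exp (- t / 4))) \<le> measure (p_exponential_measure p) {-t..t}"
proof -
  interpret prob_space "p_exponential_measure p" by fact
  let ?P = "\<lambda>t. prob {-t..t}"
  obtain c where c: "c > 0" "\<And>t. 0 < t \<Longrightarrow> t \<le> 1 \<Longrightarrow> c * t \<le> ?P t"
    using p_exponential_small_interval[OF assms(1,2)] by auto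
  \<comment> \<open>At \<open>t = 1\<close> the constant is compared with a probability; hence
    \<open>- ln c\<close> is nonnegative.\<close>
  have "c \<le> 1" using order_trans[OF c(2)[of 1] prob_le_1] by simp
  show thesis
  proof (rule that[of "- ln c" "2 / c"])
    show "exp (- (- ln c - ln t)) \<le> ?P t" if "0 < t" "t \<le> 1" for t
      using c(2)[OF that] c(1) that by (simp add: exp_add mult.commute)
    show "exp (- (2 / c * exp (- t / 4))) \<le> ?P t" if "1 \<le> t" for t
    proof -
      \<comment> \<open>This keeps the denominator \<open>?P t\<close> in the estimate below away
        from 0.\<close>
      have "c \<le> ?P 1" using c(2)[of 1] by simp
      also have "\<dots> \<le> ?P t" using that by (intro finite_measure_mono) auto
      finally have ct: "c \<le> ?P t" .
      have "?P t = 1 - prob (- {-t..t})"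
        using prob_compl[of "{-t..t}"] by (simp add: p_exponential_measure_def Compl_eq_Diff_UNIV)
      then have T: "1 - ?P t \<le> 2 * exp (- t / 4)"
        using p_exponential_tail[OF assms that] by simp
      \<comment> \<open>The inequality \<open>ln x \<le> x - 1\<close> at
        \<open>x = inverse (?P t)\<close> bounds the cost by the tail divided by
        \<open>?P t\<close>, which is where \<open>2 / c\<close> comes from.\<close>
      have "- ln (?P t) = ln (inverse (?P t))" using ct c(1) by (simp add: ln_inverse)
      also have "\<dots> \<le> inverse (?P t) - 1" using ct c(1) by (intro ln_le_minus_one) auto
      also have "\<dots> = (1 - ?P t) / ?P t" using ct c(1) by (simp add: field_simps)
      also have "\<dots> \<le> 2 * exp (- t / 4) / c" using ct c(1) T by (intro frac_le) auto
      finally have "- (2 / c * exp (- t / 4)) \<le> ln (?P t)" by (simp add: field_simps)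
      then show ?thesis using ct c(1) by (subst ln_ge_iff[symmetric]) auto
    qed
  qed (use \<open>c \<le> 1\<close> c in auto)
qed

section \<open>Summation over the levels on both sides of \<open>K\<close>\<close>

text \<open>Every distance to \<open>K\<close> occurs at most twice, once on either side.\<close>

lemma sum_nat_dist_le_suminf:
  fixes f :: "nat \<Rightarrow> real"
  assumes "summable f" "\<And>d. 0 \<le> f d"
  shows "(\<Sum>k<n. f (nat \<bar>int k - int K\<bar>)) \<le> 2 * suminf f"
proof -
  let ?d = "\<lambda>k. nat \<bar>int k - int K\<bar>"
  have part: "(\<Sum>k\<in>A. f (?d k)) \<le> suminf f" if "finite A" "inj_on ?d A" for A
  proof -
    have "(\<Sum>k\<in>A. f (?d k)) = (\<Sum>d\<in>?d ` A. f d)"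
      using that by (simp add: sum.reindex)
    also have "\<dots> \<le> suminf f"
      using assms that by (intro sum_le_suminf) auto
    finally show ?thesis .
  qed
  have "(\<Sum>k<n. f (?d k)) = (\<Sum>k\<in>{..<n} \<inter> {..K}. f (?d k)) + (\<Sum>k\<in>{..<n} \<inter> {K<..}. f (?d k))"
    by (subst sum.union_disjoint[symmetric]) (auto intro!: sum.cong)
  also have "\<dots> \<le> suminf f + suminf f"
    by (intro add_mono part) (auto simp: inj_on_def)
  finally show ?thesis by simp
qed

text \<open>\<open>2 ^ K * level_cost \<alpha> a b d\<close> bounds the contribution of a level \<open>k\<close> with \<open>\<bar>k - K\<bar> = d\<close> to the
  negative logarithm; the first summand covers \<open>k \<le> K\<close>, the second \<open>k > K\<close>.\<close>

definition level_cost :: "real \<Rightarrow> real \<Rightarrow> real \<Rightarrow> nat \<Rightarrow> real" where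
  "level_cost \<alpha> a b d =
     (1 / 2) ^ d * (a + 3 / 2 * \<alpha> * real d * ln 2) +
     2 ^ d * (b * exp (- (2 powr (\<alpha> / 2 * real d)) / 4))"

lemma level_cost_nonneg: "0 \<le> \<alpha> \<Longrightarrow> 0 \<le> a \<Longrightarrow> 0 \<le> b \<Longrightarrow> 0 \<le> level_cost \<alpha> a b d"
  unfolding level_cost_def by (intro add_nonneg_nonneg mult_nonneg_nonneg) auto

text \<open>The first summand is a linear factor times a geometric term. In the second, the doubly
  exponential decay, present because \<open>\<alpha> > 0\<close>, beats the factor
  \<open>2 ^ d\<close>.\<close>

lemma summable_level_cost:
  assumes "\<alpha> > 0"
  shows "summable (level_cost \<alpha> a b)"
proof -
  \<comment> \<open>Any ratio strictly between \<open>1 / 2\<close> and \<open>1\<close> absorbs the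
    linear factor.\<close>
  have "(\<lambda>d. real d * (1 / 2) ^ d) \<in> O(\<lambda>d. (3 / 4) ^ d)"
    by real_asymp
  then have 1: "summable (\<lambda>d. real d * (1 / 2) ^ d :: real)"
    by (rule summable_comparison_test_bigo[rotated]) (simp add: summable_geometric)
  have "(\<lambda>d. 2 ^ d * exp (- (2 powr (\<alpha> / 2 * real d)) / 4)) \<in> O(\<lambda>d. (1 / 2) ^ d)"
    using assms by real_asymp
  then have 2: "summable (\<lambda>d. 2 ^ d * exp (- (2 powr (\<alpha> / 2 * real d)) / 4))"
    by (rule summable_comparison_test_bigo[rotated]) (simp add: summable_geometric)
  have "summable (\<lambda>d. (1 / 2) ^ d * a + (3 / 2 * \<alpha> * ln 2) * (real d * (1 / 2) ^ d) +
      b * (2 ^ d * exp (- (2 powr (\<alpha> / 2 * real d)) / 4)))"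
    by (intro summable_add summable_mult summable_mult2 1 2 summable_geometric) simp
  then show ?thesis
    by (rule back_subst[of summable]) (auto simp: level_cost_def algebra_simps)
qed

section \<open>Pointwise bounds for the wavelets of one level\<close>

context cdv_wavelet_basis
begin

text \<open>The Hoelder bound compares each value with the one at 0, at distance at most 1.
  Boundedness makes the \<open>sup_norm\<close> in \<open>sup_bound\<close> a genuine
  supremum.\<close>

lemma bounded_wavelet:
  assumes "S > 0" "l \<in> {1..2 ^ k}"
  shows "bounded (\<psi> k l ` {0..1})"
proof -
  \<comment> \<open>The largest exponent that \<open>holder_bound\<close> admits; it is positive
    since \<open>S > 0\<close>.\<close>
  define \<theta> where "\<theta> = min S 1"
  have \<theta>: "0 < \<theta>" "\<theta> \<le> min S 1" using assms by (auto simp: \<theta>_def)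
  obtain C where C: "C > 0" "\<And>x y. x \<in> {0..1} \<Longrightarrow> y \<in> {0..1} \<Longrightarrow>
      \<bar>\<psi> k l x - \<psi> k l y\<bar> \<le> C * 2 powr (real k / 2 + real k * \<theta>) * \<bar>x - y\<bar> powr \<theta>"
    using holder_bound assms(2) \<theta> by blast
  let ?B = "C * 2 powr (real k / 2 + real k * \<theta>)"
  have "\<bar>\<psi> k l x\<bar> \<le> \<bar>\<psi> k l 0\<bar> + ?B" if x: "x \<in> {0..1}" for x
  proof -
    have "\<bar>\<psi> k l x - \<psi> k l 0\<bar> \<le> ?B * \<bar>x - 0\<bar> powr \<theta>"
      using x by (intro C) auto
    also have "\<dots> \<le> ?B * 1"
      using x \<theta> C(1) by (intro mult_left_mono powr_le1) auto
    finally show ?thesis by linarith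
  qed
  then show ?thesis by (intro boundedI[of _ "\<bar>\<psi> k l 0\<bar> + ?B"]) auto
qed

text \<open>Pointwise form of \<open>sup_bound\<close>, suited to partial sums and their pointwise
  limits.\<close>

lemma wavelet_level_bound:
  assumes "S > 0"
  obtains C where "C > 0"
    "\<And>k v t x. x \<in> {0..1} \<Longrightarrow> (\<And>l. l \<in> {1..2 ^ k} \<Longrightarrow> \<bar>v l\<bar> \<le> t) \<Longrightarrow>
       \<bar>\<Sum>l=1..2 ^ k. v l * \<psi> k l x\<bar> \<le> C * 2 powr (real k / 2) * t"
proof -
  obtain C where C: "C > 0" "\<And>k v. sup_norm (\<lambda>x. \<Sum>l=1..2 ^ k. v l * \<psi> k l x)
           \<le> C * 2 powr (real k / 2) * (SUP l\<in>{1..2 ^ k}. \<bar>v l\<bar>)"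
    using sup_bound by blast
  show thesis
  proof (rule that[OF C(1)])
    fix k :: nat and v :: "nat \<Rightarrow> real" and t x :: real
    assume x: "x \<in> {0..1}" and v: "\<And>l. l \<in> {1..2 ^ k} \<Longrightarrow> \<bar>v l\<bar> \<le> t"
    have "\<exists>B. \<forall>l\<in>{1..2 ^ k}. \<forall>x\<in>{0..1}. \<bar>\<psi> k l x\<bar> \<le> B l"
      using bounded_wavelet[OF assms] unfolding bounded_iff
      by (intro bchoice) (auto simp: image_iff)
    then obtain B where B: "\<And>l x. l \<in> {1..2 ^ k} \<Longrightarrow> x \<in> {0..1} \<Longrightarrow> \<bar>\<psi> k l x\<bar> \<le> B l"
      by blast
    \<comment> \<open>A crude bound that serves only to make \<open>sup_norm_le_iff\<close>
      applicable.\<close>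
    have "\<bar>\<Sum>l=1..2 ^ k. v l * \<psi> k l y\<bar> \<le> (\<Sum>l=1..2 ^ k. \<bar>v l\<bar> * B l)" if "y \<in> {0..1}" for y
      using B[OF _ that] by (intro order_trans[OF sum_abs] sum_mono) (auto simp: abs_mult intro!: mult_left_mono)
    then have bdd: "bounded ((\<lambda>x. \<Sum>l=1..2 ^ k. v l * \<psi> k l x) ` {0..1})"
      by (intro boundedI[of _ "\<Sum>l=1..2 ^ k. \<bar>v l\<bar> * B l"]) auto
    have "\<bar>\<Sum>l=1..2 ^ k. v l * \<psi> k l x\<bar> \<le> C * 2 powr (real k / 2) * (SUP l\<in>{1..2 ^ k}. \<bar>v l\<bar>)"
      using sup_norm_le_iff[OF bdd, THEN iffD1, OF C(2)] x by blast
    also have "\<dots> \<le> C * 2 powr (real k / 2) * t"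
      using C(1) v by (intro mult_left_mono cSUP_least) auto
    finally show "\<bar>\<Sum>l=1..2 ^ k. v l * \<psi> k l x\<bar> \<le> C * 2 powr (real k / 2) * t" .
  qed
qed

end

section \<open>Probabilities of events on the random coefficients\<close>

context p_exponential_series
begin

lemma distr_xi:
  assumes "(k, l) \<in> wavelet_index"
  shows "distr M borel (\<xi> k l) = p_exponential_measure p"
proof -
  have "distr M lborel (\<xi> k l) = p_exponential_measure p"
    using distributed_distr_eq_density[OF distributed_xi[OF assms]]
    by (simp add: p_exponential_measure_def)
  then show ?thesis by (simp cong: distr_cong)
qed

lemma xi_measurable:
  assumes "(k, l) \<in> wavelet_index"
  shows "\<xi> k l \<in> borel_measurable M"
  using distributed_measurable[OF distributed_xi[OF assms]] by simp

text \<open>The measure is the law of \<open>\<xi> 0 1\<close>, which settles the normalisation of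
  the density.\<close>

lemma prob_space_p_exponential_measure: "prob_space (p_exponential_measure p)"
proof -
  have "(0, 1) \<in> wavelet_index" by (simp add: wavelet_index_def)
  then show ?thesis
    using prob_space_distr[of "\<xi> 0 1" borel] distr_xi xi_measurable by metis
qed

lemma level_event_in_sets [measurable]:
  "{\<omega> \<in> space M. \<forall>l\<in>{1..2 ^ k}. \<bar>\<xi> k l \<omega>\<bar> \<le> t} \<in> events"
proof -
  have "(\<Inter>l\<in>{1..2 ^ k}. {\<omega> \<in> space M. \<bar>\<xi> k l \<omega>\<bar> \<le> t}) \<in> events"
  proof (intro sets.finite_INT)
    fix l :: nat assume "l \<in> {1..2 ^ k}"
    then have [measurable]: "\<xi> k l \<in> borel_measurable M"
      by (intro xi_measurable) (simp add: wavelet_index_def)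
    show "{\<omega> \<in> space M. \<bar>\<xi> k l \<omega>\<bar> \<le> t} \<in> events" by measurable
  qed auto
  also have "(\<Inter>l\<in>{1..2 ^ k}. {\<omega> \<in> space M. \<bar>\<xi> k l \<omega>\<bar> \<le> t}) =
      {\<omega> \<in> space M. \<forall>l\<in>{1..2 ^ k}. \<bar>\<xi> k l \<omega>\<bar> \<le> t}"
  proof -
    \<comment> \<open>Having at least one index keeps the intersection inside
      \<open>space M\<close>.\<close>
    have "1 \<in> {1..2 ^ k :: nat}" by simp
    then show ?thesis by blast
  qed
  finally show ?thesis .
qed

text \<open>Independence splits the event into one factor per index, and level \<open>k\<close>
  supplies \<open>2 ^ k\<close> equal factors.\<close>

lemma prob_levels_le:
  "prob {\<omega> \<in> space M. \<forall>k<n. \<forall>l\<in>{1..2 ^ k}. \<bar>\<xi> k l \<omega>\<bar> \<le> t k} =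
     (\<Prod>k<n. measure (p_exponential_measure p) {- t k..t k} ^ (2 ^ k))"
\<comment> \<open>Independence is applied to a nonempty finite index set, so the case without levels
  stands apart.\<close>
proof (cases "n = 0")
  case True
  then show ?thesis using prob_space by simp
next
  case False
  define J where "J = (SIGMA k:{..<n}. {1..2 ^ k :: nat})"
  let ?A = "\<lambda>(k, l :: nat). {- t k..t k}"
  have "(0, 1) \<in> J" using False by (simp add: J_def)
  then have J: "J \<noteq> {}" by blast
  have fin: "finite J" and sub: "J \<subseteq> wavelet_index"
    by (auto simp: J_def wavelet_index_def)
  have "{\<omega> \<in> space M. \<forall>k<n. \<forall>l\<in>{1..2 ^ k}. \<bar>\<xi> k l \<omega>\<bar> \<le> t k} =
      (\<Inter>j\<in>J. (case j of (k, l) \<Rightarrow> \<xi> k l) -` ?A j \<inter> space M)"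
  proof (intro set_eqI iffI)
    fix \<omega> assume *: "\<omega> \<in> (\<Inter>j\<in>J. (case j of (k, l) \<Rightarrow> \<xi> k l) -` ?A j \<inter> space M)"
    then have "\<omega> \<in> space M" using J by blast
    moreover have "\<bar>\<xi> k l \<omega>\<bar> \<le> t k" if "k < n" "l \<in> {1..2 ^ k}" for k l
    proof -
      have "(k, l) \<in> J" using that by (simp add: J_def)
      from INT_D[OF * this] show ?thesis by (simp add: abs_le_iff)
    qed
    ultimately show "\<omega> \<in> {\<omega> \<in> space M. \<forall>k<n. \<forall>l\<in>{1..2 ^ k}. \<bar>\<xi> k l \<omega>\<bar> \<le> t k}"
      by blast
  qed (auto simp: J_def abs_le_iff minus_le_iff[of "\<xi> _ _ _"])
  also have "prob \<dots> = (\<Prod>j\<in>J. prob ((case j of (k, l) \<Rightarrow> \<xi> k l) -` ?A j \<inter> space M))"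
    using indep_xi J fin sub by (rule indep_varsD) auto
  also have "\<dots> = (\<Prod>j\<in>J. measure (p_exponential_measure p) (?A j))"
  proof (intro prod.cong refl, clarify)
    fix k l assume "(k, l) \<in> J"
    then have kl: "(k, l) \<in> wavelet_index" using sub by blast
    show "prob (\<xi> k l -` {- t k..t k} \<inter> space M) = measure (p_exponential_measure p) {- t k..t k}"
      unfolding distr_xi[OF kl, symmetric]
      by (subst measure_distr) (auto intro: xi_measurable[OF kl])
  qed
  also have "\<dots> = (\<Prod>k<n. \<Prod>l\<in>{1..2 ^ k :: nat}. measure (p_exponential_measure p) {- t k..t k})"
    unfolding J_def by (subst prod.Sigma) (auto simp: case_prod_beta)
  finally show ?thesis by simp
qed

text \<open>Continuity from above: the events for the first \<open>n\<close> levels decrease to the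
  event for all levels.\<close>

lemma prob_all_levels_ge:
  assumes "\<And>n. c \<le> (\<Prod>k<n. measure (p_exponential_measure p) {- t k..t k} ^ (2 ^ k))"
  shows "c \<le> prob {\<omega> \<in> space M. \<forall>k. \<forall>l\<in>{1..2 ^ k}. \<bar>\<xi> k l \<omega>\<bar> \<le> t k}"
proof -
  define A where "A n = {\<omega> \<in> space M. \<forall>k<n. \<forall>l\<in>{1..2 ^ k}. \<bar>\<xi> k l \<omega>\<bar> \<le> t k}" for n
  have "A n \<in> events" for n
    unfolding A_def by measurable
  moreover have "decseq A"
    by (auto simp: decseq_def A_def)
  ultimately have "(\<lambda>n. prob (A n)) \<longlonglongrightarrow> prob (\<Inter>n. A n)"
    by (intro finite_Lim_measure_decseq) auto
  moreover have "c \<le> prob (A n)" for n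
    using assms unfolding A_def prob_levels_le .
  ultimately have "c \<le> prob (\<Inter>n. A n)"
    by (intro LIMSEQ_le_const) auto
  also have "(\<Inter>n. A n) = {\<omega> \<in> space M. \<forall>k. \<forall>l\<in>{1..2 ^ k}. \<bar>\<xi> k l \<omega>\<bar> \<le> t k}"
    by (auto simp: A_def)
  finally show ?thesis .
qed

end

section \<open>Thresholds: their probability and the resulting norm bound\<close>

text \<open>These are the \<open>t k\<close> of the overview. At distance \<open>d\<close> from
  \<open>K\<close> the value is \<open>2 powr (- (3 / 2 * \<alpha> * d))\<close> below
  \<open>K\<close> and \<open>2 powr (\<alpha> / 2 * d)\<close> above, so for
  \<open>\<alpha> > 0\<close> the thresholds are at most 1 up to \<open>K\<close> and at least 1
  beyond.\<close>

definition threshold :: "real \<Rightarrow> nat \<Rightarrow> nat \<Rightarrow> real" where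
  "threshold \<alpha> K k =
     2 powr (\<alpha> * (real k - real K) - \<alpha> / 2 * real (nat \<bar>int k - int K\<bar>))"

text \<open>Each level costs at most \<open>2 ^ K\<close> times a term of one fixed summable
  sequence in the distance to \<open>K\<close>; this makes the constant uniform in \<open>K\<close>
  and \<open>n\<close>.\<close>

lemma p_exponential_threshold_bound:
  assumes "prob_space (p_exponential_measure p)" "1 \<le> p" "p \<le> 2" "\<alpha> > 0"
  shows "\<exists>C\<ge>0. \<forall>K n. exp (- (C * 2 ^ K)) \<le>
    (\<Prod>k<n. measure (p_exponential_measure p) {- threshold \<alpha> K k..threshold \<alpha> K k} ^ (2 ^ k))"
proof -
  obtain a b where ab: "a \<ge> 0" "b \<ge> 0"
    "\<And>t. 0 < t \<Longrightarrow> t \<le> 1 \<Longrightarrow> exp (- (a - ln t)) \<le> measure (p_exponential_measure p) {-t..t}"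
    "\<And>t. 1 \<le> t \<Longrightarrow> exp (- (b * exp (- t / 4))) \<le> measure (p_exponential_measure p) {-t..t}"
    using p_exponential_interval_lower_bound[OF assms(1-3)] by blast
  let ?f = "level_cost \<alpha> a b"
  have f: "0 \<le> ?f d" for d using assms ab by (intro level_cost_nonneg) auto
  have level: "exp (- (2 ^ K * ?f (nat \<bar>int k - int K\<bar>))) \<le>
      measure (p_exponential_measure p) {- threshold \<alpha> K k..threshold \<alpha> K k} ^ (2 ^ k)" for K k
  proof -
    let ?t = "threshold \<alpha> K k"
    define d where "d = nat \<bar>int k - int K\<bar>"
    \<comment> \<open>\<open>h\<close> is the cost of a single coefficient, and level
      \<open>k\<close> has \<open>2 ^ k\<close> of them.\<close>
    have "\<exists>h. exp (- h) \<le> measure (p_exponential_measure p) {-?t..?t} \<and> 2 ^ k * h \<le> 2 ^ K * ?f d"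
    proof (cases "k \<le> K")
      case True
      then have K: "K = k + d" by (simp add: d_def)
      have t: "?t = 2 powr (- (3 / 2 * \<alpha> * real d))"
        by (simp add: threshold_def K algebra_simps)
      have "?t \<le> 1" unfolding t using assms powr_mono[of "- (3 / 2 * \<alpha> * real d)" 0 2] by simp
      moreover have "ln ?t = - (3 / 2 * \<alpha> * real d * ln 2)" by (simp add: t ln_powr)
      ultimately have "exp (- (a + 3 / 2 * \<alpha> * real d * ln 2))
          \<le> measure (p_exponential_measure p) {-?t..?t}"
        using ab(3)[of ?t] by (simp add: t)
      moreover have "2 ^ k * (a + 3 / 2 * \<alpha> * real d * ln 2) \<le> 2 ^ K * ?f d"
      proof -
        \<comment> \<open>Below \<open>K\<close> the cost per coefficient grows linearly in
          \<open>d\<close>, while their number falls off like \<open>(1 / 2) ^ d\<close>.\<close>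
        have "2 ^ k * (a + 3 / 2 * \<alpha> * real d * ln 2) =
            2 ^ K * ((1 / 2) ^ d * (a + 3 / 2 * \<alpha> * real d * ln 2))"
          by (simp add: K power_add power_divide)
        also have "\<dots> \<le> 2 ^ K * ?f d"
          using ab by (intro mult_left_mono) (auto simp: level_cost_def)
        finally show ?thesis .
      qed
      ultimately show ?thesis by blast
    next
      case False
      then have k: "k = K + d" by (simp add: d_def)
      have t: "?t = 2 powr (\<alpha> / 2 * real d)"
        by (simp add: threshold_def k algebra_simps)
      have "1 \<le> ?t" unfolding t using assms by (intro ge_one_powr_ge_zero) auto
      then have "exp (- (b * exp (- ?t / 4))) \<le> measure (p_exponential_measure p) {-?t..?t}"
        by (rule ab)
      moreover have "2 ^ k * (b * exp (- ?t / 4)) \<le> 2 ^ K * ?f d"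
      proof -
        have "2 ^ k * (b * exp (- ?t / 4)) = 2 ^ K * (2 ^ d * (b * exp (- ?t / 4)))"
          by (simp add: k power_add)
        also have "\<dots> \<le> 2 ^ K * ?f d"
          unfolding level_cost_def t
          using ab assms by (intro mult_left_mono) auto
        finally show ?thesis .
      qed
      ultimately show ?thesis by blast
    qed
    then obtain h where h: "exp (- h) \<le> measure (p_exponential_measure p) {-?t..?t}"
      "2 ^ k * h \<le> 2 ^ K * ?f d" by blast
    have "exp (- (2 ^ K * ?f d)) \<le> exp (- (2 ^ k * h))" using h by simp
    also have "\<dots> = exp (- h) ^ (2 ^ k)" by (simp add: exp_of_nat_mult[symmetric])
    also have "\<dots> \<le> measure (p_exponential_measure p) {-?t..?t} ^ (2 ^ k)"
      using h by (intro power_mono) auto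
    finally show ?thesis by (simp add: d_def)
  qed
  have "exp (- (2 * suminf ?f * 2 ^ K)) \<le>
    (\<Prod>k<n. measure (p_exponential_measure p) {- threshold \<alpha> K k..threshold \<alpha> K k} ^ (2 ^ k))" for K n
  proof -
    have "(\<Sum>k<n. ?f (nat \<bar>int k - int K\<bar>)) \<le> 2 * suminf ?f"
      using summable_level_cost[OF assms(4)] f by (rule sum_nat_dist_le_suminf)
    then have "exp (- (2 * suminf ?f * 2 ^ K)) \<le> exp (- ((\<Sum>k<n. ?f (nat \<bar>int k - int K\<bar>)) * 2 ^ K))"
      by simp
    also have "\<dots> = (\<Prod>k<n. exp (- (2 ^ K * ?f (nat \<bar>int k - int K\<bar>))))"
      by (simp add: exp_sum[symmetric] sum_distrib_left[symmetric] sum_negf mult.commute)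
    also have "\<dots> \<le> (\<Prod>k<n. measure (p_exponential_measure p) {- threshold \<alpha> K k..threshold \<alpha> K k} ^ (2 ^ k))"
      using level by (intro prod_mono) auto
    finally show ?thesis .
  qed
  moreover have "0 \<le> 2 * suminf ?f"
    using summable_level_cost[OF assms(4)] f by (simp add: suminf_nonneg)
  ultimately show ?thesis by blast
qed

text \<open>A deterministic estimate: the weights cancel the growth
  \<open>2 powr (real k / 2)\<close> of the level bound, and the thresholds leave geometric decay
  away from \<open>K\<close>.\<close>

lemma sup_norm_series_le:
  assumes "cdv_wavelet_basis S \<psi>" "S > 0" "\<alpha> > 0"
  shows "\<exists>D>0. \<forall>K c f.
    (\<forall>k. \<forall>l\<in>{1..2 ^ k}. \<bar>c k l\<bar> \<le> threshold \<alpha> K k) \<longrightarrow>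
    limitin (mtopology_of C01)
      (\<lambda>n. \<lambda>x\<in>{0..1}. \<Sum>k<n. \<Sum>l=1..2 ^ k. 2 powr (- (1 / 2 + \<alpha>) * real k) * c k l * \<psi> k l x)
      f sequentially \<longrightarrow>
    f \<in> mspace C01 \<and> sup_norm f \<le> D * 2 powr (- \<alpha> * real K)"
proof -
  interpret cdv_wavelet_basis S \<psi> by fact
  obtain C where C: "C > 0" "\<And>k v t x. x \<in> {0..1} \<Longrightarrow> (\<And>l. l \<in> {1..2 ^ k} \<Longrightarrow> \<bar>v l\<bar> \<le> t) \<Longrightarrow>
       \<bar>\<Sum>l=1..2 ^ k. v l * \<psi> k l x\<bar> \<le> C * 2 powr (real k / 2) * t"
    using wavelet_level_bound[OF \<open>S > 0\<close>] by blast
  define q where "q = 2 powr (- (\<alpha> / 2))"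
  have q: "0 < q" "q < 1" using assms(3) powr_less_mono[of "- (\<alpha> / 2)" 0 2] by (auto simp: q_def)
  have q_power: "2 powr (- (\<alpha> / 2) * real d) = q ^ d" for d
    by (simp add: q_def powr_powr powr_realpow[symmetric])
  \<comment> \<open>The factor 2 accounts for the two sides of \<open>K\<close>.\<close>
  define D where "D = 2 * C * suminf (\<lambda>d. q ^ d)"
  have "suminf (\<lambda>d. q ^ d) > 0"
    using q by (intro suminf_pos summable_geometric) auto
  then have "D > 0" using C(1) by (simp add: D_def)
  moreover have "f \<in> mspace C01 \<and> sup_norm f \<le> D * 2 powr (- \<alpha> * real K)"
    if c: "\<forall>k. \<forall>l\<in>{1..2 ^ k}. \<bar>c k l\<bar> \<le> threshold \<alpha> K k"
      and lim: "limitin (mtopology_of C01)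
      (\<lambda>n. \<lambda>x\<in>{0..1}. \<Sum>k<n. \<Sum>l=1..2 ^ k. 2 powr (- (1 / 2 + \<alpha>) * real k) * c k l * \<psi> k l x)
      f sequentially" for K c f
  proof -
    have f: "f \<in> mspace C01"
      using limitin_topspace[OF lim] by (simp del: mspace_cfunspace)
    have "\<bar>f x\<bar> \<le> D * 2 powr (- \<alpha> * real K)" if x: "x \<in> {0..1}" for x
    proof -
      let ?s = "\<lambda>k. \<Sum>l=1..2 ^ k. 2 powr (- (1 / 2 + \<alpha>) * real k) * c k l * \<psi> k l x"
      have s: "\<bar>?s k\<bar> \<le> C * 2 powr (- \<alpha> * real K) * q ^ nat \<bar>int k - int K\<bar>" for k
      proof -
        have "\<bar>?s k\<bar> \<le> C * 2 powr (real k / 2) * (2 powr (- (1 / 2 + \<alpha>) * real k) * threshold \<alpha> K k)"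
          using c by (intro C x) (auto simp: abs_mult)
        also have "\<dots> = C * 2 powr (real k / 2 + (- (1 / 2 + \<alpha>) * real k) +
            (\<alpha> * (real k - real K) - \<alpha> / 2 * real (nat \<bar>int k - int K\<bar>)))"
          by (simp only: threshold_def powr_add mult.assoc)
        also have "real k / 2 + (- (1 / 2 + \<alpha>) * real k) +
            (\<alpha> * (real k - real K) - \<alpha> / 2 * real (nat \<bar>int k - int K\<bar>)) =
            - \<alpha> * real K + - (\<alpha> / 2) * real (nat \<bar>int k - int K\<bar>)"
          by (simp add: field_simps)
        also have "C * 2 powr \<dots> = C * 2 powr (- \<alpha> * real K) * q ^ nat \<bar>int k - int K\<bar>"
          by (simp only: powr_add q_power mult.assoc)
        finally show ?thesis .
      qed
      have "\<bar>\<Sum>k<n. ?s k\<bar> \<le> D * 2 powr (- \<alpha> * real K)" for n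
      proof -
        have "\<bar>\<Sum>k<n. ?s k\<bar> \<le> (\<Sum>k<n. C * 2 powr (- \<alpha> * real K) * q ^ nat \<bar>int k - int K\<bar>)"
          by (rule order_trans[OF sum_abs sum_mono[OF s]])
        also have "\<dots> = C * 2 powr (- \<alpha> * real K) * (\<Sum>k<n. q ^ nat \<bar>int k - int K\<bar>)"
          by (simp add: sum_distrib_left)
        also have "\<dots> \<le> C * 2 powr (- \<alpha> * real K) * (2 * suminf (\<lambda>d. q ^ d))"
          using q C(1) by (intro mult_left_mono sum_nat_dist_le_suminf summable_geometric) auto
        finally show ?thesis by (simp add: D_def mult_ac)
      qed
      \<comment> \<open>The bound on the partial sums is uniform in \<open>n\<close>, so it survives
        the limit.\<close>
      moreover have "(\<lambda>n. \<bar>\<Sum>k<n. ?s k\<bar>) \<longlonglongrightarrow> \<bar>f x\<bar>"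
        using limitin_C01_imp_tendsto[OF lim x] x by (intro tendsto_rabs) simp
      ultimately show ?thesis
        by (intro LIMSEQ_le_const2) auto
    qed
    then show ?thesis
      using f sup_norm_le_iff[OF bounded_image_C01[OF f]] by blast
  qed
  ultimately show ?thesis by blast
qed

section \<open>Small-ball probabilities\<close>

text \<open>On the threshold event the norm bound holds, and the probability of that event is
  already bounded below. \<open>C\<close> and \<open>D\<close> are chosen before \<open>K\<close>,
  which stays free to be matched to \<epsilon>.\<close>

lemma (in p_exponential_series) small_ball_dyadic:
  assumes "cdv_wavelet_basis S \<psi>" "S > 0" "\<alpha> > 0" "1 \<le> p" "p \<le> 2"
  obtains C D where "C \<ge> 0" "D > 0" "\<And>K \<epsilon>. D * 2 powr (- \<alpha> * real K) \<le> \<epsilon> \<Longrightarrow>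
    exp (- (C * 2 ^ K)) \<le> measure (distr M borel_C01 u) {f \<in> mspace C01. sup_norm f \<le> \<epsilon>}"
proof -
  obtain C where C: "C \<ge> 0" "\<And>K n. exp (- (C * 2 ^ K)) \<le>
    (\<Prod>k<n. measure (p_exponential_measure p) {- threshold \<alpha> K k..threshold \<alpha> K k} ^ (2 ^ k))"
    using p_exponential_threshold_bound[OF prob_space_p_exponential_measure assms(4,5,3)] by blast
  obtain D where D: "D > 0" "\<And>K c f.
    (\<forall>k. \<forall>l\<in>{1..2 ^ k}. \<bar>c k l\<bar> \<le> threshold \<alpha> K k) \<Longrightarrow>
    limitin (mtopology_of C01)
      (\<lambda>n. \<lambda>x\<in>{0..1}. \<Sum>k<n. \<Sum>l=1..2 ^ k. 2 powr (- (1 / 2 + \<alpha>) * real k) * c k l * \<psi> k l x)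
      f sequentially \<Longrightarrow>
    f \<in> mspace C01 \<and> sup_norm f \<le> D * 2 powr (- \<alpha> * real K)"
    using sup_norm_series_le[OF assms(1-3)] by blast
  show thesis
  proof (rule that[OF C(1) D(1)])
    fix K :: nat and \<epsilon> :: real assume \<epsilon>: "D * 2 powr (- \<alpha> * real K) \<le> \<epsilon>"
    let ?B = "{f \<in> mspace C01. sup_norm f \<le> \<epsilon>}"
    have "exp (- (C * 2 ^ K)) \<le>
        prob {\<omega> \<in> space M. \<forall>k. \<forall>l\<in>{1..2 ^ k}. \<bar>\<xi> k l \<omega>\<bar> \<le> threshold \<alpha> K k}"
      by (rule prob_all_levels_ge[OF C(2)])
    also have "\<dots> \<le> prob (u -` ?B \<inter> space M)"
    proof (rule finite_measure_mono_AE)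
      \<comment> \<open>The series converges to \<open>u\<close> almost surely, so the inclusion of
        events holds up to a null set.\<close>
      show "AE \<omega> in M. \<omega> \<in> {\<omega> \<in> space M. \<forall>k. \<forall>l\<in>{1..2 ^ k}. \<bar>\<xi> k l \<omega>\<bar> \<le> threshold \<alpha> K k}
          \<longrightarrow> \<omega> \<in> u -` ?B \<inter> space M"
        using series_converges
      proof eventually_elim
        case (elim \<omega>)
        show ?case
        proof
          assume A: "\<omega> \<in> {\<omega> \<in> space M. \<forall>k. \<forall>l\<in>{1..2 ^ k}. \<bar>\<xi> k l \<omega>\<bar> \<le> threshold \<alpha> K k}"
          then have "u \<omega> \<in> mspace C01 \<and> sup_norm (u \<omega>) \<le> D * 2 powr (- \<alpha> * real K)"
            using elim by (intro D(2)[of "\<lambda>k l. \<xi> k l \<omega>"]) auto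
          with A \<epsilon> show "\<omega> \<in> u -` ?B \<inter> space M"
            by (auto simp del: mspace_cfunspace)
        qed
      qed
    qed (rule measurable_sets[OF measurable_u sup_norm_ball_in_sets])
    also have "\<dots> = measure (distr M borel_C01 u) ?B"
      using measure_distr[OF measurable_u sup_norm_ball_in_sets] by simp
    finally show "exp (- (C * 2 ^ K)) \<le> measure (distr M borel_C01 u) ?B" .
  qed
qed

text \<open>The dyadic bound is applied with the least \<open>K\<close> for which
  \<open>D * 2 powr (- \<alpha> * real K) \<le> \<epsilon>\<close>. Positivity is asserted
  separately because \<open>ln\<close> of a vanishing probability would not be infinite.\<close>

theorem proposition6p3:
  fixes \<alpha> p S :: real
    and \<psi> :: "nat \<Rightarrow> nat \<Rightarrow> real \<Rightarrow> real"
    and M :: "'a measure"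
    and \<xi> :: "nat \<Rightarrow> nat \<Rightarrow> 'a \<Rightarrow> real"
    and u :: "'a \<Rightarrow> real \<Rightarrow> real"
    and \<mu> :: "(real \<Rightarrow> real) measure"
  assumes "\<alpha> > 0" and "1 \<le> p" and "p \<le> 2"
    and "S > \<alpha>" and "cdv_wavelet_basis S \<psi>"
    and "p_exponential_series M \<alpha> p \<psi> \<xi> u"
    and "\<mu> = distr M borel_C01 u"
  shows "(\<forall>\<^sub>F \<epsilon> in at_right 0. measure \<mu> {f \<in> mspace C01. sup_norm f \<le> \<epsilon>} > 0) \<and>
    (\<lambda>\<epsilon>. - ln (measure \<mu> {f \<in> mspace C01. sup_norm f \<le> \<epsilon>}))
      \<in> O[at_right 0](\<lambda>\<epsilon>. \<epsilon> powr (- 1 / \<alpha>))"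
proof -
  interpret p_exponential_series M \<alpha> p \<psi> \<xi> u by fact
  interpret \<mu>: prob_space \<mu>
    unfolding assms(7) by (rule prob_space_distr[OF measurable_u])
  let ?P = "\<lambda>\<epsilon>. measure \<mu> {f \<in> mspace C01. sup_norm f \<le> \<epsilon>}"
  have "S > 0" using assms by simp
  then obtain C D where CD: "C \<ge> 0" "D > 0"
    "\<And>K \<epsilon>. D * 2 powr (- \<alpha> * real K) \<le> \<epsilon> \<Longrightarrow> exp (- (C * 2 ^ K)) \<le> ?P \<epsilon>"
    using small_ball_dyadic[OF assms(5) _ assms(1-3)] unfolding assms(7) by blast
  \<comment> \<open>\<open>C\<close> is the cost constant, 2 the price of rounding to a power of
    two, and \<open>D powr (1 / \<alpha>)\<close> the effect of rescaling \<epsilon>.\<close>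
  have key: "0 < ?P \<epsilon> \<and> - ln (?P \<epsilon>) \<le> C * 2 * D powr (1 / \<alpha>) * \<epsilon> powr (- 1 / \<alpha>)"
    if \<epsilon>: "\<epsilon> \<in> {0<..<D}" for \<epsilon>
  proof -
    \<comment> \<open>\<open>r\<close> solves \<open>D * r powr (- \<alpha>) = \<epsilon>\<close>,
      so it is the ideal value of \<open>2 ^ K\<close>.\<close>
    define r where "r = (D / \<epsilon>) powr (1 / \<alpha>)"
    have r: "r \<ge> 1" unfolding r_def using \<epsilon> assms(1) by (intro ge_one_powr_ge_zero) auto
    \<comment> \<open>Since \<open>r \<ge> 1\<close> the logarithm is nonnegative and
      \<open>nat\<close> truncates nothing.\<close>
    define K where "K = nat \<lceil>log 2 r\<rceil>"
    have "log 2 r \<ge> 0" using r by simp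
    then have "log 2 r \<le> real K" "real K \<le> log 2 r + 1"
      unfolding K_def by linarith+
    then have "2 powr (log 2 r) \<le> 2 powr (real K)" "2 powr (real K) \<le> 2 powr (log 2 r + 1)"
      by (intro powr_mono; simp)+
    then have K: "r \<le> 2 powr real K" "2 ^ K \<le> 2 * r"
      using r by (simp_all add: powr_add powr_realpow)
    have "D / \<epsilon> = r powr \<alpha>" using \<epsilon> CD(2) assms(1) by (simp add: r_def powr_powr)
    also have "\<dots> \<le> (2 powr real K) powr \<alpha>"
      using K r assms(1) by (intro powr_mono2) auto
    finally have "D / \<epsilon> \<le> 2 powr (\<alpha> * real K)" by (simp add: powr_powr mult.commute)
    then have "D * 2 powr (- \<alpha> * real K) \<le> \<epsilon>"
      using \<epsilon> by (simp add: powr_minus field_simps)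
    then have P: "exp (- (C * 2 ^ K)) \<le> ?P \<epsilon>" by (rule CD(3))
    then have pos: "0 < ?P \<epsilon>" by (rule less_le_trans[OF exp_gt_zero])
    have "- (C * 2 ^ K) \<le> ln (?P \<epsilon>)" using P pos by (simp add: ln_ge_iff)
    then have "- ln (?P \<epsilon>) \<le> C * 2 ^ K" by simp
    also have "\<dots> \<le> C * (2 * r)" using K CD(1) by (intro mult_left_mono)
    also have "r = D powr (1 / \<alpha>) * \<epsilon> powr (- 1 / \<alpha>)"
      using \<epsilon> CD(2) by (simp add: r_def powr_divide powr_minus_divide)
    finally show ?thesis using pos by (simp add: mult.assoc)
  qed
  have ev: "\<forall>\<^sub>F \<epsilon> in at_right 0. \<epsilon> \<in> {0<..<D}"
    using CD(2) by (rule eventually_at_right_real)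
  show ?thesis
  proof
    show "\<forall>\<^sub>F \<epsilon> in at_right 0. 0 < ?P \<epsilon>"
      using ev by eventually_elim (use key in blast)
    show "(\<lambda>\<epsilon>. - ln (?P \<epsilon>)) \<in> O[at_right 0](\<lambda>\<epsilon>. \<epsilon> powr (- 1 / \<alpha>))"
    proof (rule bigoI)
      show "\<forall>\<^sub>F \<epsilon> in at_right 0. norm (- ln (?P \<epsilon>)) \<le>
          (C * 2 * D powr (1 / \<alpha>)) * norm (\<epsilon> powr (- 1 / \<alpha>))"
        using ev
      proof eventually_elim
        case (elim \<epsilon>)
        \<comment> \<open>The \<open>O\<close> bound concerns the absolute value, so the sign of
          \<open>- ln\<close> is needed too.\<close>
        have "ln (?P \<epsilon>) \<le> 0" using key[OF elim] \<mu>.prob_le_1 by simp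
        then show ?case using key[OF elim] by simp
      qed
    qed
  qed
qed

end
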